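(* Let $\nu$ be a Lévy measure on $(\mathbb{R}^T,\mathcal{B}^T)$. The following are equivalent: (i) $\nu$ is $\sigma$-finite; (ii) $\nu^*(\{0_T\})=0$, where $\nu^*$ is the outer measure; (iii) $\nu\{x\in\mathbb{R}^T: x_{T_0}=0\}=0$ for some nonempty countable set $T_0\subset T$.
   Context: $T$ is an arbitrary nonempty set, $\mathbb{R}^T$ the space of all functions $x:T\to\mathbb{R}$, $\mathcal{B}^T$ its cylindrical (product) $\sigma$-algebra, $0_T$ the zero function, $x_{T_0}$ the restriction of $x$ to $T_0$. For a measure $\nu$ on $(\mathbb{R}^T,\mathcal{B}^T)$ and $E\subset\mathbb{R}^T$, the inner and outer measures are $\nu_*(E)=\sup\{\nu(D):D\subset E,\ D\in\mathcal{B}^T\}$ and $\nu^*(E)=\inf\{\nu(D):D\supset E,\ D\in\mathcal{B}^T\}$. A measure $\nu$ on $(\mathbb{R}^T,\mathcal{B}^T)$ is a Lévy measure if (L1) $\int_{\mathbb{R}^T}|x(t)|^2\wedge1\,\nu(dx)<\infty$ for every $t\in T$, and (L2) $\nu(A)=\nu_*(A\setminus\{0_T\})$ for every $A\in\mathcal{B}^T$. Countable includes finite. *)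

theory Defs
  imports "HOL-Analysis.Analysis"
begin

(* R^T is the space of (PiM T (\<lambda>_. borel)), that is, PiE T (\<lambda>_. UNIV): the functions that are
   undefined off T. Its zero element is therefore the restriction of the constant zero function. *)
definition zero_fun :: "'t set \<Rightarrow> 't \<Rightarrow> real" where
  "zero_fun T = (\<lambda>_\<in>T. 0)"

(* Counterpart of the library's outer_measure_of. *)
definition inner_measure_of :: "'a measure \<Rightarrow> 'a set \<Rightarrow> ennreal" where
  "inner_measure_of M E = (SUP D \<in> {D \<in> sets M. D \<subseteq> E}. emeasure M D)"

definition levy_measure :: "'t set \<Rightarrow> ('t \<Rightarrow> real) measure \<Rightarrow> bool" where
  "levy_measure T \<nu> \<longleftrightarrow>
     sets \<nu> = sets (PiM T (\<lambda>_. borel :: real measure)) \<and>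
     (\<forall>t\<in>T. (\<integral>\<^sup>+ x. ennreal (min (\<bar>x t\<bar>\<^sup>2) 1) \<partial>\<nu>) < \<infinity>) \<and>
     (\<forall>A\<in>sets \<nu>. emeasure \<nu> A = inner_measure_of \<nu> (A - {zero_fun T}))"

end

theory Submission
  imports Defs
begin

text \<open>
  The link between the three conditions is that a cylindrical event only looks at countably many
  coordinates (\<open>PiM_set_countably_determined\<close>). A measurable set containing \<open>0\<^sub>T\<close> therefore contains a
  whole cylinder \<open>{x. x = 0 on T\<^sub>0}\<close> with \<open>T\<^sub>0\<close> countable. These cylinders are themselves measurable
  and contain \<open>0\<^sub>T\<close>, so \<open>0\<^sub>T\<close> has outer measure zero exactly when one of them is a null set. This
  much holds for every measure on the cylindrical \<open>\<sigma>\<close>-algebra.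

  The two Levy conditions enter through \<open>\<sigma>\<close>-finiteness, one in each direction. If a cylinder over
  \<open>T\<^sub>0\<close> is null, its complement is the countable union of the sets \<open>{x. \<bar>x t\<bar> \<ge> 1 / n}\<close> with \<open>t \<in> T\<^sub>0\<close>,
  which have finite measure by Markov's inequality and (L1). Conversely, if \<open>\<nu>\<close> is \<open>\<sigma>\<close>-finite, some
  measurable set \<open>S\<close> of finite measure contains \<open>0\<^sub>T\<close>; by (L2) it is exhausted up to an arbitrarily
  small error by measurable sets that miss \<open>0\<^sub>T\<close>, and the complements in \<open>S\<close> of these sets are
  measurable covers of \<open>0\<^sub>T\<close> of arbitrarily small measure.
\<close>

text \<open>The sets with this property form a \<open>\<sigma>\<close>-algebra, since a countable union of countable index sets
  is countable, and this \<open>\<sigma>\<close>-algebra contains the one-coordinate cylinders.\<close>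
lemma PiM_set_countably_determined:
  assumes "D \<in> sets (PiM I M)"
  shows "\<exists>J. countable J \<and> J \<subseteq> I \<and>
    (\<forall>x\<in>space (PiM I M). \<forall>y\<in>space (PiM I M). (\<forall>i\<in>J. x i = y i) \<longrightarrow> (x \<in> D \<longleftrightarrow> y \<in> D))"
  using assms unfolding sets_PiM_single
proof (induction rule: sigma_sets.induct)
  case (Basic D)
  then obtain i A where "i \<in> I" and "D = {f \<in> (\<Pi>\<^sub>E i\<in>I. space (M i)). f i \<in> A}"
    by blast
  then show ?case
    by (intro exI[of _ "{i}"]) (auto simp: space_PiM)
next
  case Empty
  show ?case by (intro exI[of _ "{}"]) simp
next
  case (Compl D)
  then show ?case
    by (simp add: space_PiM)
next
  case (Union D)
  have "\<exists>J. \<forall>n. countable (J n) \<and> J n \<subseteq> I \<and> (\<forall>x\<in>space (PiM I M). \<forall>y\<in>space (PiM I M).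
    (\<forall>i\<in>J n. x i = y i) \<longrightarrow> (x \<in> D n \<longleftrightarrow> y \<in> D n))"
    by (rule choice) (use Union.IH in simp)
  then obtain J where J: "\<forall>n. countable (J n) \<and> J n \<subseteq> I \<and>
    (\<forall>x\<in>space (PiM I M). \<forall>y\<in>space (PiM I M).
      (\<forall>i\<in>J n. x i = y i) \<longrightarrow> (x \<in> D n \<longleftrightarrow> y \<in> D n))"
    by (rule exE)
  show ?case
  proof (intro exI[of _ "\<Union>n. J n"] conjI ballI impI)
    show "countable (\<Union>n. J n)" "(\<Union>n. J n) \<subseteq> I"
      using J by auto
    fix x y
    assume xy: "x \<in> space (PiM I M)" "y \<in> space (PiM I M)" "\<forall>i\<in>\<Union>n. J n. x i = y i"
    have "x \<in> D n \<longleftrightarrow> y \<in> D n" for n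
    proof -
      have "\<forall>i\<in>J n. x i = y i"
        using xy(3) by blast
      then show ?thesis
        using J[THEN spec, of n] xy(1,2) by blast
    qed
    then show "x \<in> (\<Union>n. D n) \<longleftrightarrow> y \<in> (\<Union>n. D n)"
      by simp
  qed
qed

lemma restrict_eq_zero_fun_iff:
  "restrict x J = zero_fun J \<longleftrightarrow> (\<forall>t\<in>J. x t = 0)"
  by (auto simp: zero_fun_def restrict_def fun_eq_iff)

lemma sets_zero_cylinder:
  assumes sets: "sets \<nu> = sets (PiM T (\<lambda>_. borel :: real measure))"
    and "countable J" "J \<subseteq> T"
  shows "{x \<in> space \<nu>. restrict x J = zero_fun J} \<in> sets \<nu>"
proof -
  have [measurable]: "(\<lambda>x. x t) \<in> borel_measurable \<nu>" if "t \<in> J" for t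
    using that \<open>J \<subseteq> T\<close> by (subst measurable_cong_sets[OF sets refl]) auto
  show ?thesis
    unfolding restrict_eq_zero_fun_iff
    using \<open>countable J\<close> by measurable
qed

lemma zero_fun_in_space:
  assumes "sets \<nu> = sets (PiM T (\<lambda>_. borel :: real measure))"
  shows "zero_fun T \<in> space \<nu>"
  using sets_eq_imp_space_eq[OF assms] by (simp add: space_PiM zero_fun_def)

text \<open>The null set witnessing that \<open>0\<^sub>T\<close> has outer measure zero is shrunk to a cylinder over the
  countably many coordinates that determine it.\<close>
lemma outer_measure_zero_fun_eq_0_iff:
  assumes "T \<noteq> {}" and sets: "sets \<nu> = sets (PiM T (\<lambda>_. borel :: real measure))"
  shows "outer_measure_of \<nu> {zero_fun T} = 0 \<longleftrightarrow>
    (\<exists>J. J \<noteq> {} \<and> countable J \<and> J \<subseteq> T \<and>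
      emeasure \<nu> {x \<in> space \<nu>. restrict x J = zero_fun J} = 0)"
    (is "_ \<longleftrightarrow> ?null_cylinder")
proof
  have space: "space \<nu> = space (PiM T (\<lambda>_. borel :: real measure))"
    by (rule sets_eq_imp_space_eq[OF sets])
  assume "outer_measure_of \<nu> {zero_fun T} = 0"
  moreover obtain D where "D \<in> sets \<nu>" "zero_fun T \<in> D"
    "outer_measure_of \<nu> {zero_fun T} = emeasure \<nu> D"
    using outer_measure_of_attain[of "{zero_fun T}" \<nu>] zero_fun_in_space[OF sets] by auto
  ultimately have D: "D \<in> sets \<nu>" "zero_fun T \<in> D" "emeasure \<nu> D = 0"
    by simp_all
  obtain J where J: "countable J" "J \<subseteq> T"
    "\<And>x y. x \<in> space \<nu> \<Longrightarrow> y \<in> space \<nu> \<Longrightarrow> (\<forall>t\<in>J. x t = y t) \<Longrightarrow> x \<in> D \<longleftrightarrow> y \<in> D"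
    using PiM_set_countably_determined[of D T "\<lambda>_. borel"] D(1) unfolding sets space by metis
  obtain t where "t \<in> T"
    using \<open>T \<noteq> {}\<close> by blast
  \<comment> \<open>A set such as the whole space is determined by no coordinate at all; adjoining \<open>t\<close> keeps the
    index set nonempty.\<close>
  let ?J = "insert t J"
  have "{x \<in> space \<nu>. restrict x ?J = zero_fun ?J} \<subseteq> D"
  proof safe
    fix x
    assume x: "x \<in> space \<nu>" "restrict x ?J = zero_fun ?J"
    then have "\<forall>s\<in>J. x s = zero_fun T s"
      using J(2) unfolding restrict_eq_zero_fun_iff by (auto simp: zero_fun_def)
    then show "x \<in> D"
      using J(3)[OF x(1) zero_fun_in_space[OF sets]] D(2) by simp
  qed
  then have "emeasure \<nu> {x \<in> space \<nu>. restrict x ?J = zero_fun ?J} \<le> emeasure \<nu> D"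
    using D(1) by (rule emeasure_mono)
  then show ?null_cylinder
    using D(3) J(1,2) \<open>t \<in> T\<close> by (intro exI[of _ ?J]) auto
next
  assume ?null_cylinder
  then obtain J where J: "countable J" "J \<subseteq> T"
    "emeasure \<nu> {x \<in> space \<nu>. restrict x J = zero_fun J} = 0" (is "emeasure \<nu> ?Z = 0")
    by blast
  have "zero_fun T \<in> ?Z"
    using J(2) zero_fun_in_space[OF sets] unfolding restrict_eq_zero_fun_iff
    by (auto simp: zero_fun_def)
  then have "outer_measure_of \<nu> {zero_fun T} \<le> outer_measure_of \<nu> ?Z"
    by (intro outer_measure_of_mono) simp
  also have "\<dots> = 0"
    using J sets_zero_cylinder[OF sets J(1,2)] by simp
  finally show "outer_measure_of \<nu> {zero_fun T} = 0"
    by simp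
qed

text \<open>This is Markov's inequality for \<open>\<bar>x t\<bar>\<^sup>2 \<and> 1\<close>; the bound \<open>\<epsilon> \<le> 1\<close> makes the truncation
  harmless.\<close>
lemma levy_measure_finite_away_from_0:
  assumes levy: "levy_measure T \<nu>" and "t \<in> T" "0 < \<epsilon>" "\<epsilon> \<le> 1"
  shows "{x \<in> space \<nu>. \<epsilon> \<le> \<bar>x t\<bar>} \<in> sets \<nu>"
    and "emeasure \<nu> {x \<in> space \<nu>. \<epsilon> \<le> \<bar>x t\<bar>} < \<infinity>"
proof -
  have sets: "sets \<nu> = sets (PiM T (\<lambda>_. borel :: real measure))"
    and L1: "(\<integral>\<^sup>+ x. ennreal (min (\<bar>x t\<bar>\<^sup>2) 1) \<partial>\<nu>) < \<infinity>"
    using levy \<open>t \<in> T\<close> by (auto simp: levy_measure_def)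
  have [measurable]: "(\<lambda>x. x t) \<in> borel_measurable \<nu>"
    using \<open>t \<in> T\<close> by (subst measurable_cong_sets[OF sets refl]) auto
  show meas: "{x \<in> space \<nu>. \<epsilon> \<le> \<bar>x t\<bar>} \<in> sets \<nu>" (is "?A \<in> _")
    by measurable
  have "ennreal (\<epsilon>\<^sup>2) * emeasure \<nu> ?A = (\<integral>\<^sup>+ x. ennreal (\<epsilon>\<^sup>2) * indicator ?A x \<partial>\<nu>)"
    using meas by (simp add: nn_integral_cmult_indicator)
  also have "\<dots> \<le> (\<integral>\<^sup>+ x. ennreal (min (\<bar>x t\<bar>\<^sup>2) 1) \<partial>\<nu>)"
  proof (rule nn_integral_mono)
    fix x
    have "\<epsilon>\<^sup>2 \<le> min (\<bar>x t\<bar>\<^sup>2) 1" if "\<epsilon> \<le> \<bar>x t\<bar>"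
      using that assms(3,4) power_mono[of \<epsilon> "\<bar>x t\<bar>" 2] power_le_one[of \<epsilon> 2] by simp
    then show "ennreal (\<epsilon>\<^sup>2) * indicator ?A x \<le> ennreal (min (\<bar>x t\<bar>\<^sup>2) 1)"
      by (auto simp: indicator_def intro!: ennreal_leI)
  qed
  finally have "ennreal (\<epsilon>\<^sup>2) * emeasure \<nu> ?A < \<infinity>"
    using L1 by (rule le_less_trans)
  then show "emeasure \<nu> ?A < \<infinity>"
    using \<open>0 < \<epsilon>\<close> by (auto simp: ennreal_mult_less_top)
qed

lemma levy_measure_sigma_finite_if_null_cylinder:
  assumes levy: "levy_measure T \<nu>" and J: "countable J" "J \<subseteq> T"
    and null: "emeasure \<nu> {x \<in> space \<nu>. restrict x J = zero_fun J} = 0" (is "emeasure \<nu> ?Z = 0")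
  shows "sigma_finite_measure \<nu>"
proof
  have sets: "sets \<nu> = sets (PiM T (\<lambda>_. borel :: real measure))"
    using levy by (simp add: levy_measure_def)
  define A where "A = (\<lambda>(t, n). {x \<in> space \<nu>. 1 / real (Suc n) \<le> \<bar>x t\<bar>})"
  have A: "A p \<in> sets \<nu> \<and> emeasure \<nu> (A p) < \<infinity>" if "p \<in> J \<times> UNIV" for p
  proof -
    obtain t n where "p = (t, n)" "t \<in> T"
      using \<open>p \<in> J \<times> UNIV\<close> J(2) by blast
    then show ?thesis
      using levy_measure_finite_away_from_0[OF levy \<open>t \<in> T\<close>, of "1 / real (Suc n)"]
      by (simp add: A_def)
  qed
  have "x \<in> ?Z \<or> (\<exists>p\<in>J \<times> UNIV. x \<in> A p)" if "x \<in> space \<nu>" for x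
  proof (cases "\<forall>t\<in>J. x t = 0")
    case True
    then show ?thesis
      using that by (simp add: restrict_eq_zero_fun_iff)
  next
    case False
    then obtain t where t: "t \<in> J" "0 < \<bar>x t\<bar>"
      by auto
    then obtain n where "1 / real (Suc n) < \<bar>x t\<bar>"
      using nat_approx_posE by blast
    then have "x \<in> A (t, n)"
      using that by (simp add: A_def)
    then show ?thesis
      using t(1) by blast
  qed
  then have cover: "space \<nu> \<subseteq> \<Union> (insert ?Z (A ` (J \<times> UNIV)))"
    by auto
  let ?\<A> = "insert ?Z (A ` (J \<times> UNIV))"
  show "\<exists>\<A>. countable \<A> \<and> \<A> \<subseteq> sets \<nu> \<and> \<Union> \<A> = space \<nu> \<and> (\<forall>a\<in>\<A>. emeasure \<nu> a \<noteq> \<infinity>)"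
  proof (intro exI[of _ ?\<A>] conjI)
    show "countable ?\<A>"
      using J(1) by (intro countable_insert countable_image countable_SIGMA) auto
    show sub: "?\<A> \<subseteq> sets \<nu>"
      using A sets_zero_cylinder[OF sets J] by auto
    show "\<Union> ?\<A> = space \<nu>"
    proof (rule antisym[OF Union_least cover])
      show "B \<subseteq> space \<nu>" if "B \<in> ?\<A>" for B
        using that sub by (intro sets.sets_into_space) (rule subsetD)
    qed
    show "\<forall>a\<in>?\<A>. emeasure \<nu> a \<noteq> \<infinity>"
    proof
      fix a
      assume "a \<in> ?\<A>"
      then consider "a = ?Z" | p where "p \<in> J \<times> UNIV" "a = A p"
        by blast
      then show "emeasure \<nu> a \<noteq> \<infinity>"
        using A null by cases (simp, blast dest: less_imp_neq)
    qed
  qed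
qed

text \<open>A measurable \<open>D\<close> inside \<open>S - {z}\<close> leaves the measurable cover \<open>S - D\<close> of \<open>z\<close>, so the outer
  measure of \<open>{z}\<close> is at most the defect of \<open>D\<close> in \<open>S\<close>. Removing \<open>z\<close> from \<open>S\<close> without lowering the inner
  measure makes that defect arbitrarily small; finiteness of \<open>S\<close> lets the defect be computed by
  subtraction.\<close>
lemma outer_measure_singleton_eq_0:
  assumes S: "S \<in> sets M" "z \<in> S" "emeasure M S < \<infinity>"
    and inner: "emeasure M S = inner_measure_of M (S - {z})"
  shows "outer_measure_of M {z} = 0"
proof -
  have le: "emeasure M D \<le> emeasure M S - outer_measure_of M {z}"
    if D: "D \<in> sets M" "D \<subseteq> S - {z}" for D
  proof -
    have "outer_measure_of M {z} \<le> outer_measure_of M (S - D)"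
      using S(2) D(2) by (intro outer_measure_of_mono) auto
    also have "\<dots> = emeasure M (S - D)"
      using S(1) D(1) by simp
    finally have "emeasure M D + outer_measure_of M {z} \<le> emeasure M D + emeasure M (S - D)"
      by (rule add_left_mono)
    also have "\<dots> = emeasure M S"
      using S(1) D by (subst plus_emeasure) (auto intro!: arg_cong[where f = "emeasure M"])
    finally show ?thesis
      using S(3) by (intro ennreal_le_minus_iff[THEN iffD2] disjI1) (auto simp: add.commute)
  qed
  have "emeasure M S \<le> emeasure M S - outer_measure_of M {z}"
    by (subst inner) (auto simp: inner_measure_of_def intro!: SUP_least le)
  moreover have "outer_measure_of M {z} \<le> emeasure M S"
    using S outer_measure_of_mono[of "{z}" S M] by simp
  ultimately show ?thesis
    using S(3) by (cases "outer_measure_of M {z}"; cases "emeasure M S")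
      (auto simp: ennreal_minus)
qed

theorem theorem2p12:
  fixes T :: "'t set" and \<nu> :: "('t \<Rightarrow> real) measure"
  assumes "T \<noteq> {}"
    and "levy_measure T \<nu>"
  shows "(sigma_finite_measure \<nu> \<longleftrightarrow> outer_measure_of \<nu> {zero_fun T} = 0) \<and>
         (outer_measure_of \<nu> {zero_fun T} = 0 \<longleftrightarrow>
           (\<exists>T0. T0 \<noteq> {} \<and> countable T0 \<and> T0 \<subseteq> T \<and>
             emeasure \<nu> {x \<in> space \<nu>. restrict x T0 = zero_fun T0} = 0))"
proof -
  have sets: "sets \<nu> = sets (PiM T (\<lambda>_. borel :: real measure))"
    and L2: "\<And>A. A \<in> sets \<nu> \<Longrightarrow> emeasure \<nu> A = inner_measure_of \<nu> (A - {zero_fun T})"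
    using assms(2) by (auto simp: levy_measure_def)
  note outer_iff = outer_measure_zero_fun_eq_0_iff[OF assms(1) sets]
  have "outer_measure_of \<nu> {zero_fun T} = 0" if sigma_finite: "sigma_finite_measure \<nu>"
  proof -
    obtain \<A> where \<A>: "\<A> \<subseteq> sets \<nu>" "\<Union> \<A> = space \<nu>" "\<forall>a\<in>\<A>. emeasure \<nu> a \<noteq> \<infinity>"
      using sigma_finite_measure.sigma_finite_countable[OF sigma_finite] by blast
    then obtain S where S: "S \<in> \<A>" "zero_fun T \<in> S"
      using zero_fun_in_space[OF sets] by blast
    show ?thesis
    proof (rule outer_measure_singleton_eq_0)
      show "S \<in> sets \<nu>" "zero_fun T \<in> S"
        using S \<A>(1) by blast+
      then show "emeasure \<nu> S = inner_measure_of \<nu> (S - {zero_fun T})"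
        by (intro L2)
      show "emeasure \<nu> S < \<infinity>"
        using S(1) \<A>(3) by (simp add: less_top)
    qed
  qed
  moreover have "sigma_finite_measure \<nu>" if "outer_measure_of \<nu> {zero_fun T} = 0"
    using that levy_measure_sigma_finite_if_null_cylinder[OF assms(2)] unfolding outer_iff by blast
  ultimately show ?thesis
    using outer_iff by blast
qed

end
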